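(* We have \[ \int_{1}^{\infty} \int_{0}^{1} \int_{0}^{1} \frac{dz \, dy \, dx}{x(x+y)(x+y+z)} = \frac{5}{24}\, \zeta(3), \] where $x$ ranges over $(1,\infty)$ and $y, z$ range over $(0,1)$.
   Context: $\zeta$ denotes the Riemann zeta function, so $\zeta(3) = \sum_{n=1}^\infty 1/n^3$. *)

theory Defs
  imports "HOL-Analysis.Analysis"
begin

text \<open>The Riemann zeta function on the half-line \<open>s > 1\<close>, where it is given by its
  Dirichlet series. The definition carries no meaning for \<open>s \<le> 1\<close>.\<close>

definition zeta :: "real \<Rightarrow> real" where
  "zeta s = (\<Sum>n. 1 / real (Suc n) powr s)"

end

theory Submission
  imports Defs "HOL-Real_Asymp.Real_Asymp"
begin

text \<open>
  With \<open>Li\<close> denoting the polylogarithm, integrating over \<open>z\<close> and \<open>y\<close> leaves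
  \<open>(Li\<^sub>2 (- 1 / (x + 1)) - Li\<^sub>2 (- 1 / x)) / x\<close> to be integrated over \<open>x > 1\<close>. It has an
  antiderivative in terms of \<open>Li\<^sub>3\<close> at seven arguments rational in \<open>x\<close>. By the functional
  equations of Landen and Spence-Kummer there are many such antiderivatives; the one chosen
  is special in that at \<open>x = 1\<close> the values of \<open>Li\<^sub>3\<close> at \<open>1 / 2\<close>, \<open>1 / 3\<close> and \<open>- 1 / 3\<close> cancel.
  At both endpoints only \<open>Li\<^sub>3 1\<close> and \<open>Li\<^sub>3 (- 1) = - 3 / 4 * \<zeta>(3)\<close> remain, so no functional
  equation has to be proved.
\<close>

section \<open>Polylogarithm series: convergence, continuity, derivatives, duplication\<close>

definition polylog :: "nat \<Rightarrow> real \<Rightarrow> real" where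
  "polylog k u = (\<Sum>n. u ^ Suc n / real (Suc n) ^ k)"

lemma summable_polylog:
  assumes "k \<ge> 2" "\<bar>u\<bar> \<le> 1"
  shows "summable (\<lambda>n. u ^ Suc n / real (Suc n) ^ k)"
proof (rule summable_comparison_test')
  show "summable (\<lambda>n. 1 / real (Suc n) ^ k)"
    using inverse_power_summable[of k, where 'a = real] assms(1)
    by (subst summable_Suc_iff) (simp add: inverse_eq_divide)
  show "norm (u ^ Suc n / real (Suc n) ^ k) \<le> 1 / real (Suc n) ^ k" for n
    using power_le_one[of "\<bar>u\<bar>" "Suc n"] assms(2)
    by (simp add: norm_divide norm_power power_abs divide_right_mono del: of_nat_Suc power_Suc)
qed

text \<open>Weierstrass M-test, with the terms at \<open>u = 1\<close> as majorant. The interval is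
  closed because limits at the arguments 1 and -1 are taken later.\<close>

lemma continuous_on_polylog:
  assumes "k \<ge> 2"
  shows "continuous_on {-1..1} (polylog k)"
proof -
  have "uniform_limit {-1..1} (\<lambda>n x. \<Sum>i<n. x ^ Suc i / real (Suc i) ^ k)
          (\<lambda>x. \<Sum>i. x ^ Suc i / real (Suc i) ^ k) sequentially"
  proof (rule Weierstrass_m_test)
    show "summable (\<lambda>n. 1 ^ Suc n / real (Suc n) ^ k)"
      by (rule summable_polylog) (use assms in auto)
    show "norm (x ^ Suc n / real (Suc n) ^ k) \<le> 1 ^ Suc n / real (Suc n) ^ k"
      if "x \<in> {-1..1}" for n and x :: real
      using power_le_one[of "\<bar>x\<bar>" "Suc n"] that
      by (simp add: norm_divide norm_power power_abs divide_right_mono abs_le_iff del: of_nat_Suc power_Suc)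
  qed
  moreover have "continuous_on {-1..1::real} (\<lambda>x. \<Sum>i<n. x ^ Suc i / real (Suc i) ^ k)" for n
    by (intro continuous_intros) auto
  ultimately have "continuous_on {-1..1} (\<lambda>x. \<Sum>i. x ^ Suc i / real (Suc i) ^ k)"
    by (intro uniform_limit_theorem) auto
  then show ?thesis
    by (simp add: polylog_def[abs_def])
qed

lemma polylog_at_0: "polylog k 0 = 0"
  by (simp add: polylog_def)

lemma polylog_1:
  assumes "\<bar>u\<bar> < 1"
  shows "polylog 1 u = - ln (1 - u)"
proof -
  \<comment> \<open>\<open>ln_series\<close> expands \<open>ln\<close> in powers of its argument
    minus 1. At the argument \<open>1 - u\<close> this is \<open>- u\<close>, whose sign cancels the
    alternation.\<close>
  have eq: "(- 1) ^ n * (1 / real (n + 1)) * (1 - u - 1) ^ Suc n = - (u ^ Suc n / real (Suc n) ^ 1)" for n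
  proof -
    have "(1 - u - 1) ^ Suc n = (-1) ^ n * (- (u ^ Suc n))"
      using power_mult_distrib[of "-1" u "Suc n"] by simp
    moreover have "(-1::real) ^ n * (-1) ^ n = 1"
      by (simp flip: power_add)
    ultimately show ?thesis
      by (simp add: mult.assoc mult.left_commute del: power_Suc)
  qed
  have "ln (1 - u) = (\<Sum>n. - (u ^ Suc n / real (Suc n) ^ 1))"
    using ln_series[of "1 - u"] assms unfolding eq by auto
  also have "\<dots> = - polylog 1 u"
  proof -
    have "summable (\<lambda>n. u ^ Suc n / real (Suc n) ^ 1)"
    proof (rule summable_comparison_test')
      show "summable (\<lambda>n. \<bar>u\<bar> ^ Suc n)"
        using assms by (subst summable_Suc_iff) (simp add: summable_geometric)
      have "\<bar>u\<bar> ^ Suc n / real (Suc n) ^ 1 \<le> \<bar>u\<bar> ^ Suc n / 1" for n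
        by (intro divide_left_mono one_le_power) auto
      then show "norm (u ^ Suc n / real (Suc n) ^ 1) \<le> \<bar>u\<bar> ^ Suc n" for n
        by (simp add: norm_divide norm_power power_abs del: of_nat_Suc power_Suc)
    qed
    then show ?thesis
      unfolding polylog_def by (rule suminf_minus)
  qed
  finally show ?thesis by simp
qed

text \<open>Termwise differentiation inside the radius of convergence. Without a division by
  \<open>u\<close>, this form also covers \<open>u = 0\<close>.\<close>

lemma DERIV_polylog_series:
  assumes "\<bar>u\<bar> < 1"
  shows "(polylog (Suc k) has_real_derivative (\<Sum>n. u ^ n / real (Suc n) ^ k)) (at u)"
proof -
  have "DERIV (\<lambda>x. \<Sum>n. (1 / real (Suc n) ^ Suc k) * x ^ Suc n) u
          :> (\<Sum>n. (1 / real (Suc n) ^ Suc k) * real (Suc n) * u ^ n)"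
  proof (rule DERIV_power_series'[where R = 1])
    fix x :: real assume "x \<in> {-1<..<1}"
    show "summable (\<lambda>n. (1 / real (Suc n) ^ Suc k) * real (Suc n) * x ^ n)"
    proof (rule summable_comparison_test')
      show "summable (\<lambda>n. \<bar>x\<bar> ^ n)"
        using \<open>x \<in> _\<close> by (simp add: summable_geometric abs_less_iff)
      have "\<bar>x\<bar> ^ n / real (Suc n) ^ k \<le> \<bar>x\<bar> ^ n / 1" for n
        by (intro divide_left_mono one_le_power) auto
      then show "norm (1 / real (Suc n) ^ Suc k * real (Suc n) * x ^ n) \<le> \<bar>x\<bar> ^ n" for n
        by (simp add: norm_divide norm_mult norm_power power_abs abs_mult del: of_nat_Suc)
    qed
  qed (use assms in auto)
  then show ?thesis
    by (simp add: polylog_def[abs_def])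
qed

lemma DERIV_polylog:
  assumes "\<bar>u\<bar> < 1" "u \<noteq> 0"
  shows "(polylog (Suc k) has_real_derivative polylog k u / u) (at u)"
proof -
  have "(\<Sum>n. u ^ n / real (Suc n) ^ k) = polylog k u / u"
  proof -
    have "summable (\<lambda>n. u ^ Suc n / real (Suc n) ^ k)"
    proof (rule summable_comparison_test')
      show "summable (\<lambda>n. \<bar>u\<bar> ^ Suc n)"
        using assms by (subst summable_Suc_iff) (simp add: summable_geometric)
      have "\<bar>u\<bar> ^ Suc n / real (Suc n) ^ k \<le> \<bar>u\<bar> ^ Suc n / 1" for n
        by (intro divide_left_mono one_le_power) auto
      then show "norm (u ^ Suc n / real (Suc n) ^ k) \<le> \<bar>u\<bar> ^ Suc n" for n
        by (simp add: norm_divide norm_power power_abs del: of_nat_Suc power_Suc)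
    qed
    from suminf_divide[OF this, of u] show ?thesis
      using assms by (simp add: polylog_def)
  qed
  then show ?thesis
    using DERIV_polylog_series[OF assms(1), of k] by simp
qed

text \<open>The quotient is the difference quotient at 0, so its limit is the derivative there, the
  constant term 1 of the differentiated series. It will balance logarithms that multiply a
  polylogarithm of small argument.\<close>

lemma polylog_over_id_tendsto: "((\<lambda>u. polylog (Suc k) u / u) \<longlongrightarrow> 1) (at 0)"
proof -
  have "(\<Sum>n. (0::real) ^ n / real (Suc n) ^ k) = 1"
    by (subst suminf_finite[of "{0}"]) auto
  then show ?thesis
    using DERIV_polylog_series[of 0 k] by (simp add: DERIV_def polylog_at_0)
qed

lemma DERIV_polylog_2:
  assumes "(u has_real_derivative u') (at x)" "\<bar>u x\<bar> < 1" "u x \<noteq> 0"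
  shows "((\<lambda>x. polylog 2 (u x)) has_real_derivative - ln (1 - u x) / u x * u') (at x)"
  using DERIV_chain2[OF _ assms(1), of "polylog 2" "- ln (1 - u x) / u x"]
    DERIV_polylog[of "u x" 1] assms polylog_1[of "u x"] by (simp add: numeral_2_eq_2)

text \<open>Odd powers cancel and even powers double; pulling the factor 2 out of the even indices
  gives \<open>2 ^ k\<close>. For \<open>k = 3\<close> and \<open>u = 1\<close> it relates the
  values at -1 and 1.\<close>

lemma polylog_duplication:
  assumes "k \<ge> 2" "\<bar>u\<bar> \<le> 1"
  shows "polylog k u + polylog k (- u) = 2 * polylog k (u\<^sup>2) / 2 ^ k"
proof -
  let ?f = "\<lambda>n. u ^ Suc n / real (Suc n) ^ k + (- u) ^ Suc n / real (Suc n) ^ k"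
  have "polylog k u + polylog k (- u) = suminf ?f"
    unfolding polylog_def using assms by (intro suminf_add summable_polylog) auto
  \<comment> \<open>The term of index \<open>n\<close> has exponent \<open>n + 1\<close>, so the
    surviving even exponents sit at the odd indices \<open>2 * m + 1\<close>.\<close>
  also have "\<dots> = (\<Sum>m. ?f (2 * m + 1))"
  proof (rule suminf_mono_reindex[symmetric])
    show "strict_mono (\<lambda>m::nat. 2 * m + 1)" by (auto intro: strict_monoI)
    fix n :: nat assume "n \<notin> range (\<lambda>m. 2 * m + 1)"
    then have "even n" by (metis oddE rangeI)
    then show "?f n = 0" by simp
  qed
  also have "\<dots> = (\<Sum>m. (2 / 2 ^ k) * ((u\<^sup>2) ^ Suc m / real (Suc m) ^ k))"
  proof (rule suminf_cong)
    fix m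
    have "real (Suc (2 * m + 1)) = 2 * real (Suc m)" by simp
    moreover have "(- u) ^ Suc (2 * m + 1) = (u\<^sup>2) ^ Suc m" "u ^ Suc (2 * m + 1) = (u\<^sup>2) ^ Suc m"
      using power_mult[of "- u" 2 "Suc m"] power_mult[of u 2 "Suc m"] by simp_all
    ultimately show "?f (2 * m + 1) = (2 / 2 ^ k) * ((u\<^sup>2) ^ Suc m / real (Suc m) ^ k)"
      by (simp add: power_mult_distrib del: power_Suc of_nat_Suc)
  qed
  also have "\<dots> = (2 / 2 ^ k) * polylog k (u\<^sup>2)"
    unfolding polylog_def using assms
    by (intro suminf_mult summable_polylog) (auto simp: abs_square_le_1)
  finally show ?thesis by simp
qed

lemma zeta_eq_polylog: "zeta (real k) = polylog k 1"
  by (simp add: zeta_def polylog_def powr_realpow del: of_nat_Suc)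

section \<open>The trilogarithm with logarithmic correction terms\<close>

text \<open>The correction terms make the derivative elementary: \<open>ln\<^sup>2 \<bar>u\<bar> / (2 * (1 - u))\<close>. As
  \<open>ln 0 = 0\<close>, the values at \<open>0\<close> and \<open>1\<close> are also the limits there.\<close>

definition trilog :: "real \<Rightarrow> real" where
  "trilog u = polylog 3 u - ln \<bar>u\<bar> * polylog 2 u - (ln \<bar>u\<bar>)\<^sup>2 * ln (1 - u) / 2"

text \<open>Only 0, where \<open>ln \<bar>u\<bar>\<close> is singular, and 1, where
  \<open>ln (1 - u)\<close> is, need care: each singular logarithm meets a factor that vanishes fast
  enough.\<close>

lemma continuous_on_trilog: "continuous_on {-1..1} trilog"
proof -
  have "continuous (at u within {-1..1}) (\<lambda>u. ln \<bar>u\<bar> * polylog 2 u)" if "u \<in> {-1..1}" for u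
  proof (cases "u = 0")
    case True
    \<comment> \<open>The product is split as \<open>ln \<bar>u\<bar> * u\<close>, which tends to 0,
      times \<open>polylog 2 u / u\<close>, which tends to 1.\<close>
    have "((\<lambda>u::real. ln \<bar>u\<bar> * u) \<longlongrightarrow> 0) (at 0)"
      by (rule filterlim_split_at; real_asymp)
    from tendsto_mult[OF this polylog_over_id_tendsto[of 1]]
    have "((\<lambda>u. ln \<bar>u\<bar> * u * (polylog 2 u / u)) \<longlongrightarrow> 0) (at 0)"
      by (simp add: numeral_2_eq_2)
    moreover have "eventually (\<lambda>u::real. ln \<bar>u\<bar> * u * (polylog 2 u / u) = ln \<bar>u\<bar> * polylog 2 u) (at 0)"
      by (auto simp: eventually_at intro!: exI[of _ 1])
    ultimately have "((\<lambda>u. ln \<bar>u\<bar> * polylog 2 u) \<longlongrightarrow> 0) (at 0)"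
      by (rule Lim_transform_eventually)
    then have "isCont (\<lambda>u. ln \<bar>u\<bar> * polylog 2 u) 0"
      by (simp add: isCont_def polylog_at_0)
    then show ?thesis
      using True continuous_at_imp_continuous_at_within by blast
  next
    case False
    then show ?thesis
      using continuous_on_polylog[of 2] that
      by (intro continuous_intros) (auto simp: continuous_on_eq_continuous_within)
  qed
  moreover have "continuous (at u within {-1..1}) (\<lambda>u. (ln \<bar>u\<bar>)\<^sup>2 * ln (1 - u))"
    if u: "u \<in> {-1..1}" for u :: real
  proof -
    consider "u = 0" | "u = 1" | "u \<noteq> 0" "u < 1" using u by fastforce
    then show "continuous (at u within {-1..1}) (\<lambda>u. (ln \<bar>u\<bar>)\<^sup>2 * ln (1 - u))"
    proof cases
      case 1
      have "((\<lambda>u::real. (ln \<bar>u\<bar>)\<^sup>2 * ln (1 - u)) \<longlongrightarrow> 0) (at 0)"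
        by (rule filterlim_split_at; real_asymp)
      then have "isCont (\<lambda>u::real. (ln \<bar>u\<bar>)\<^sup>2 * ln (1 - u)) 0"
        by (simp add: isCont_def)
      then show ?thesis
        using 1 continuous_at_imp_continuous_at_within by blast
    next
      case 2
      \<comment> \<open>The double zero of \<open>(ln \<bar>u\<bar>)\<^sup>2\<close> at 1 outweighs
        the logarithmic singularity of \<open>ln (1 - u)\<close>.\<close>
      have "((\<lambda>u::real. (ln \<bar>u\<bar>)\<^sup>2 * ln (1 - u)) \<longlongrightarrow> 0) (at_left 1)"
        by real_asymp
      moreover have "at (1::real) within {-1..1} = at_left 1"
        by (rule at_within_nhd[of _ "{0<..<2}"]) auto
      ultimately show ?thesis
        using 2 by (simp add: continuous_within)
    next
      case 3
      then show ?thesis by (intro continuous_intros) auto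
    qed
  qed
  ultimately have "continuous_on {-1..1} (\<lambda>u. ln \<bar>u\<bar> * polylog 2 u)"
      "continuous_on {-1..1::real} (\<lambda>u. (ln \<bar>u\<bar>)\<^sup>2 * ln (1 - u))"
    unfolding continuous_on_eq_continuous_within by blast+
  then show ?thesis
    unfolding trilog_def[abs_def]
    by (intro continuous_on_diff continuous_on_divide continuous_on_const continuous_on_polylog) auto
qed

text \<open>At 1 and -1 the corrections vanish with \<open>ln \<bar>u\<bar>\<close>; duplication
  gives \<open>polylog 3 (- 1) = zeta 3 / 4 - zeta 3\<close>.\<close>

lemma trilog_at_0: "trilog 0 = 0" and trilog_at_1: "trilog 1 = zeta 3"
  and trilog_at_minus_1: "trilog (- 1) = - (3 / 4) * zeta 3"
  using zeta_eq_polylog[of 3] polylog_duplication[of 3 1]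
  by (simp_all add: trilog_def polylog_at_0)

lemma DERIV_square:
  fixes f :: "real \<Rightarrow> real"
  assumes "(f has_real_derivative f') (at x)"
  shows "((\<lambda>x. (f x)\<^sup>2) has_real_derivative 2 * f x * f') (at x)"
  using DERIV_power[OF assms, of 2] by (simp add: mult_ac)

lemma DERIV_trilog:
  assumes "\<bar>u\<bar> < 1" "u \<noteq> 0"
  shows "(trilog has_real_derivative (ln \<bar>u\<bar>)\<^sup>2 / (2 * (1 - u))) (at u)"
proof -
  have ln: "((\<lambda>u. ln \<bar>u\<bar>) has_real_derivative 1 / u) (at u)"
  proof -
    \<comment> \<open>Writing the function through \<open>u\<^sup>2\<close> treats both signs of
      \<open>u\<close> at once.\<close>
    have "(\<lambda>u::real. ln \<bar>u\<bar>) = (\<lambda>u. ln (u\<^sup>2) / 2)"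
    proof
      fix u :: real
      show "ln \<bar>u\<bar> = ln (u\<^sup>2) / 2"
        using ln_realpow[of "\<bar>u\<bar>" 2] by (cases "u = 0") auto
    qed
    moreover have "((\<lambda>u::real. ln (u\<^sup>2) / 2) has_real_derivative 1 / u) (at u)"
      using assms by (auto intro!: derivative_eq_intros simp: power2_eq_square zero_less_mult_iff)
    ultimately show ?thesis by simp
  qed
  have 3: "(polylog 3 has_real_derivative polylog 2 u / u) (at u)"
    using DERIV_polylog[OF assms, of 2] by (simp add: numeral_3_eq_3 numeral_2_eq_2)
  have 2: "(polylog 2 has_real_derivative - ln (1 - u) / u) (at u)"
    using DERIV_polylog[OF assms, of 1] polylog_1[of u] assms by (simp add: numeral_2_eq_2)
  have ln1: "((\<lambda>u. ln (1 - u)) has_real_derivative - 1 / (1 - u)) (at u)"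
    using assms by (auto intro!: derivative_eq_intros)
  have "(trilog has_real_derivative polylog 2 u / u
      - (1 / u * polylog 2 u + - ln (1 - u) / u * ln \<bar>u\<bar>)
      - (2 * ln \<bar>u\<bar> * (1 / u) * ln (1 - u) + - 1 / (1 - u) * (ln \<bar>u\<bar>)\<^sup>2) / 2) (at u)"
    unfolding trilog_def[abs_def] using assms
    by (intro DERIV_diff DERIV_mult DERIV_cdivide 2 3 ln ln1 DERIV_square)
  also have "polylog 2 u / u - (1 / u * polylog 2 u + - ln (1 - u) / u * ln \<bar>u\<bar>)
      - (2 * ln \<bar>u\<bar> * (1 / u) * ln (1 - u) + - 1 / (1 - u) * (ln \<bar>u\<bar>)\<^sup>2) / 2
      = (ln \<bar>u\<bar>)\<^sup>2 / (2 * (1 - u))"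
    using assms by (simp add: field_simps)
  finally show ?thesis .
qed

text \<open>In every application \<open>u x\<close> and \<open>1 - u x\<close> factor, up to sign
  and a constant, into powers of \<open>x\<close>, \<open>x + 1\<close> and \<open>x + 2\<close>.
  Hence \<open>l\<close> is a linear combination of the logarithms of these factors, and
  \<open>d\<close>, minus the logarithmic derivative of \<open>1 - u x\<close>, one of their
  reciprocals.\<close>

lemma DERIV_trilog_chain:
  assumes "(u has_real_derivative u') (at x)" "\<bar>u x\<bar> < 1" "u x \<noteq> 0"
    and "ln \<bar>u x\<bar> = l" "1 - u x = w" "u' / w = d"
  shows "((\<lambda>x. trilog (u x)) has_real_derivative l\<^sup>2 / 2 * d) (at x)"
proof -
  have "(ln \<bar>u x\<bar>)\<^sup>2 / (2 * (1 - u x)) * u' = l\<^sup>2 / 2 * d"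
    unfolding assms(4,5) assms(6)[symmetric] by simp
  then show ?thesis
    using DERIV_chain2[OF DERIV_trilog assms(1)] assms(2,3) by metis
qed

text \<open>The limit may be an endpoint of the interval, where only continuity from within is
  known; hence \<open>u\<close> has to stay in the interval eventually.\<close>

lemma tendsto_polylog_2:
  assumes "(u \<longlongrightarrow> l) F" "l \<in> {-1..1}" "eventually (\<lambda>x. u x \<in> {-1..1}) F"
  shows "((\<lambda>x. polylog 2 (u x)) \<longlongrightarrow> polylog 2 l) F"
  by (rule continuous_on_tendsto_compose[OF continuous_on_polylog]) (use assms in auto)

lemma tendsto_trilog:
  assumes "(u \<longlongrightarrow> l) F" "l \<in> {-1..1}" "eventually (\<lambda>x. u x \<in> {-1..1}) F"
  shows "((\<lambda>x. trilog (u x)) \<longlongrightarrow> trilog l) F"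
  by (rule continuous_on_tendsto_compose[OF continuous_on_trilog]) (use assms in auto)

section \<open>Integration over z and y\<close>

text \<open>By the chain rule, since \<open>ln (1 + 1 / s) = ln (s + 1) - ln s\<close>. Up to the
  factor \<open>1 / x\<close>, this is what the integration over \<open>z\<close> leaves at
  \<open>s = x + y\<close>.\<close>

lemma DERIV_polylog_2_neg_inverse:
  assumes "s > 1"
  shows "((\<lambda>s. polylog 2 (- 1 / s)) has_real_derivative (ln (s + 1) - ln s) / s) (at s)"
proof -
  have "((\<lambda>s. - 1 / s) has_real_derivative 1 / s\<^sup>2) (at s)"
    using assms by (auto intro!: derivative_eq_intros simp: power2_eq_square)
  then have "((\<lambda>s. polylog 2 (- 1 / s)) has_real_derivative
      - ln (1 - - 1 / s) / (- 1 / s) * (1 / s\<^sup>2)) (at s)"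
    by (rule DERIV_polylog_2) (use assms in auto)
  moreover have "ln (1 - - 1 / s) = ln (s + 1) - ln s"
  proof -
    have "1 - - 1 / s = (s + 1) / s" using assms by (simp add: field_simps)
    then show ?thesis using assms by (simp add: ln_div)
  qed
  ultimately show ?thesis
    using assms by (simp add: power2_eq_square)
qed

lemma integral_z:
  fixes x s :: real
  assumes "x > 0" "s > 0"
  shows "(LBINT z=0..1. 1 / (x * s * (s + z))) = (ln (s + 1) - ln s) / (x * s)"
proof -
  have "(LBINT z=ereal 0..ereal 1. 1 / (x * s * (s + z))) = ln (s + 1) / (x * s) - ln (s + 0) / (x * s)"
  proof (rule interval_integral_FTC_finite)
    show "continuous_on {min 0 1..max 0 1} (\<lambda>z. 1 / (x * s * (s + z)))"
      using assms by (intro continuous_intros) auto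
    fix z :: real assume "min 0 1 \<le> z"
    then show "((\<lambda>z. ln (s + z) / (x * s)) has_vector_derivative 1 / (x * s * (s + z)))
        (at z within {min 0 1..max 0 1})"
      using assms
      by (auto intro!: derivative_eq_intros simp flip: has_real_derivative_iff_has_vector_derivative)
  qed
  then show ?thesis
    by (simp add: diff_divide_distrib zero_ereal_def one_ereal_def)
qed

lemma integral_y_z:
  fixes x :: real
  assumes "x > 1"
  shows "(LBINT y=0..1. (LBINT z=0..1. 1 / (x * (x + y) * (x + y + z))))
    = (polylog 2 (- 1 / (x + 1)) - polylog 2 (- 1 / x)) / x"
proof -
  have "(LBINT y=0..1. (LBINT z=0..1. 1 / (x * (x + y) * (x + y + z))))
      = (LBINT y=ereal 0..ereal 1. (ln (x + y + 1) - ln (x + y)) / (x * (x + y)))"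
    using assms unfolding zero_ereal_def[symmetric] one_ereal_def[symmetric]
    by (intro interval_integral_cong integral_z) (auto simp: einterval_def min_def)
  also have "\<dots> = polylog 2 (- 1 / (x + 1)) / x - polylog 2 (- 1 / (x + 0)) / x"
  proof (rule interval_integral_FTC_finite)
    show "continuous_on {min 0 1..max 0 1} (\<lambda>y. (ln (x + y + 1) - ln (x + y)) / (x * (x + y)))"
      using assms by (intro continuous_intros) auto
    fix y :: real assume "min 0 1 \<le> y"
    then have "((\<lambda>y. polylog 2 (- 1 / (x + y))) has_real_derivative
        (ln (x + y + 1) - ln (x + y)) / (x + y) * 1) (at y)"
      using assms by (intro DERIV_chain2[OF DERIV_polylog_2_neg_inverse])
        (auto intro!: derivative_eq_intros)
    from DERIV_cdivide[OF this, of x]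
    have "((\<lambda>y. polylog 2 (- 1 / (x + y)) / x) has_real_derivative
        (ln (x + y + 1) - ln (x + y)) / (x * (x + y))) (at y)"
      by (simp add: mult.commute)
    then show "((\<lambda>y. polylog 2 (- 1 / (x + y)) / x) has_vector_derivative
        (ln (x + y + 1) - ln (x + y)) / (x * (x + y))) (at y within {min 0 1..max 0 1})"
      by (simp add: has_field_derivative_at_within flip: has_real_derivative_iff_has_vector_derivative)
  qed
  finally show ?thesis
    by (simp add: diff_divide_distrib)
qed

section \<open>An antiderivative of the remaining integrand\<close>

text \<open>Apart from the first, the terms pair off at \<open>x = 1\<close> with opposite signs:
  two arguments become \<open>1 / 2\<close>, two \<open>1 / 3\<close> and two
  \<open>- 1 / 3\<close>.\<close>

definition trilog_part :: "real \<Rightarrow> real" where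
  "trilog_part x = - (1 / 6) * trilog (- 1 / x)
    + 1 / 2 * (trilog (x / (x + 1)) - trilog (1 / (x + 1)))
    + 1 / 3 * (trilog (1 / (x + 2)) - trilog (x / (x + 2)) + trilog (- x / (x + 2))
        - trilog (- 1 / (x * (x + 2))))"

text \<open>A primitive of the terms cubic in logarithms by which the derivative of the other two
  parts of \<open>antideriv\<close> differs from the integrand.\<close>

definition log_part :: "real \<Rightarrow> real" where
  "log_part x = (ln x)\<^sup>2 * (ln (x + 2) - ln x) / 2 + ln x * (ln (x + 2) - ln x)\<^sup>2 / 6
    - (ln x)\<^sup>2 * (ln (x + 1) - ln x) - ln x * (ln (x + 1) - ln x)\<^sup>2 / 4"

text \<open>The first summand comes from integration by parts with \<open>ln x\<close> as primitive
  of \<open>1 / x\<close>. The other two remove \<open>ln x\<close> times the derivative of the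
  dilogarithm difference.\<close>

definition antideriv :: "real \<Rightarrow> real" where
  "antideriv x = ln x * (polylog 2 (- 1 / (x + 1)) - polylog 2 (- 1 / x))
    - trilog_part x - log_part x"

lemma neg_inverse_mult_bounds:
  fixes x :: real
  assumes "x > 1"
  shows "- 1 / (x * (x + 2)) \<in> {-1..1}"
proof -
  have "1 < x * (x + 2)" using mult_strict_mono[of 1 x 1 "x + 2"] assms by simp
  then show ?thesis by (auto simp: divide_simps)
qed

lemma DERIV_antideriv:
  assumes "x > 1"
  shows "(antideriv has_real_derivative (polylog 2 (- 1 / (x + 1)) - polylog 2 (- 1 / x)) / x) (at x)"
proof -
  \<comment> \<open>With logarithms and reciprocals named, every derivative below is quadratic in
    \<open>p\<close>, \<open>q\<close>, \<open>r\<close> and linear in \<open>X\<close>,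
    \<open>Y\<close>, \<open>Z\<close>, except for undifferentiated dilogarithms and the derivatives
    of single logarithms and dilogarithms, which have lower degree in \<open>p\<close>,
    \<open>q\<close>, \<open>r\<close>.\<close>
  define p q r where "p = ln x" and "q = ln (x + 1)" and "r = ln (x + 2)"
  define X Y Z where "X = 1 / x" and "Y = 1 / (x + 1)" and "Z = 1 / (x + 2)"
  note defs = p_def q_def r_def X_def Y_def Z_def
  have p: "(ln has_real_derivative X) (at x)"
    and q: "((\<lambda>x. ln (x + 1)) has_real_derivative Y) (at x)"
    and r: "((\<lambda>x. ln (x + 2)) has_real_derivative Z) (at x)"
    unfolding defs using assms by (auto intro!: derivative_eq_intros)
  have L0: "((\<lambda>x. polylog 2 (- 1 / x)) has_real_derivative (q - p) * X) (at x)"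
    using DERIV_polylog_2_neg_inverse[OF assms] by (simp add: defs)
  have L1: "((\<lambda>x. polylog 2 (- 1 / (x + 1))) has_real_derivative (r - q) * Y) (at x)"
  proof -
    have "((\<lambda>x. polylog 2 (- 1 / (x + 1))) has_real_derivative
        (ln (x + 1 + 1) - ln (x + 1)) / (x + 1) * 1) (at x)"
      using assms by (intro DERIV_chain2[OF DERIV_polylog_2_neg_inverse])
        (auto intro!: derivative_eq_intros)
    then show ?thesis by (simp add: defs add.assoc)
  qed
  have M1: "((\<lambda>x. trilog (- 1 / x)) has_real_derivative (- p)\<^sup>2 / 2 * (X - Y)) (at x)"
    by (rule DERIV_trilog_chain[where u' = "1 / x\<^sup>2" and w = "(x + 1) / x"])
       (use assms in \<open>auto intro!: derivative_eq_intros simp: defs ln_div divide_simps power2_eq_square\<close>)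
  have M2: "((\<lambda>x. trilog (x / (x + 1))) has_real_derivative (p - q)\<^sup>2 / 2 * Y) (at x)"
    by (rule DERIV_trilog_chain[where u' = "1 / (x + 1)\<^sup>2" and w = "1 / (x + 1)"])
       (use assms in \<open>auto intro!: derivative_eq_intros simp: defs ln_div divide_simps power2_eq_square\<close>)
  have M3: "((\<lambda>x. trilog (1 / (x + 1))) has_real_derivative (- q)\<^sup>2 / 2 * (Y - X)) (at x)"
    by (rule DERIV_trilog_chain[where u' = "- 1 / (x + 1)\<^sup>2" and w = "x / (x + 1)"])
       (use assms in \<open>auto intro!: derivative_eq_intros simp: defs ln_div divide_simps power2_eq_square\<close>)
  have M4: "((\<lambda>x. trilog (1 / (x + 2))) has_real_derivative (- r)\<^sup>2 / 2 * (Z - Y)) (at x)"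
    by (rule DERIV_trilog_chain[where u' = "- 1 / (x + 2)\<^sup>2" and w = "(x + 1) / (x + 2)"])
       (use assms in \<open>auto intro!: derivative_eq_intros simp: defs ln_div divide_simps power2_eq_square\<close>)
  have M5: "((\<lambda>x. trilog (x / (x + 2))) has_real_derivative (p - r)\<^sup>2 / 2 * Z) (at x)"
    by (rule DERIV_trilog_chain[where u' = "2 / (x + 2)\<^sup>2" and w = "2 / (x + 2)"])
       (use assms in \<open>auto intro!: derivative_eq_intros simp: defs ln_div divide_simps power2_eq_square\<close>)
  have M6: "((\<lambda>x. trilog (- x / (x + 2))) has_real_derivative (p - r)\<^sup>2 / 2 * (Z - Y)) (at x)"
  proof (rule DERIV_trilog_chain)
    show "((\<lambda>x. - x / (x + 2)) has_real_derivative - 2 / (x + 2)\<^sup>2) (at x)"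
      using assms by (auto intro!: derivative_eq_intros simp: divide_simps power2_eq_square)
    show "\<bar>- x / (x + 2)\<bar> < 1" "- x / (x + 2) \<noteq> 0"
      using assms by (auto simp: divide_simps)
    show "ln \<bar>- x / (x + 2)\<bar> = p - r"
      using assms by (simp add: defs ln_div)
    \<comment> \<open>The constant 2 cancels against the numerator of the derivative, so no
      \<open>ln 2\<close> arises.\<close>
    show "1 - - x / (x + 2) = 2 * (x + 1) / (x + 2)"
      using assms by (simp add: divide_simps)
    have "- 2 / (x + 2)\<^sup>2 / (2 * (x + 1) / (x + 2)) = - 1 / ((x + 1) * (x + 2))"
      using assms by (simp add: divide_simps power2_eq_square) (simp add: algebra_simps)
    also have "\<dots> = Z - Y"
      using assms by (simp add: defs divide_simps)
    finally show "- 2 / (x + 2)\<^sup>2 / (2 * (x + 1) / (x + 2)) = Z - Y" .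
  qed
  have M7: "((\<lambda>x. trilog (- 1 / (x * (x + 2)))) has_real_derivative
      (- p - r)\<^sup>2 / 2 * (X + Z - 2 * Y)) (at x)"
  proof (rule DERIV_trilog_chain)
    have "1 < x * (x + 2)" using mult_strict_mono[of 1 x 1 "x + 2"] assms by simp
    then show "((\<lambda>x. - 1 / (x * (x + 2))) has_real_derivative (2 * x + 2) / (x * (x + 2))\<^sup>2) (at x)"
      by (auto intro!: derivative_eq_intros simp: power2_eq_square add_divide_distrib diff_divide_distrib)
    show "\<bar>- 1 / (x * (x + 2))\<bar> < 1" "- 1 / (x * (x + 2)) \<noteq> 0"
      using \<open>1 < x * (x + 2)\<close> by auto
    show "ln \<bar>- 1 / (x * (x + 2))\<bar> = - p - r"
      using assms by (simp add: defs ln_div ln_mult abs_mult)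
    have "1 - - 1 / (x * (x + 2)) = (x * (x + 2) + 1) / (x * (x + 2))"
      using assms by (simp add: add_divide_distrib)
    \<comment> \<open>This perfect square is why the argument \<open>- 1 / (x * (x + 2))\<close>
      introduces no new factor.\<close>
    also have "x * (x + 2) + 1 = (x + 1)\<^sup>2"
      by (simp add: algebra_simps power2_eq_square)
    finally show "1 - - 1 / (x * (x + 2)) = (x + 1)\<^sup>2 / (x * (x + 2))" .
    have "(2 * x + 2) / (x * (x + 2))\<^sup>2 / ((x + 1)\<^sup>2 / (x * (x + 2))) = 2 / (x * (x + 1) * (x + 2))"
      using assms by (simp add: divide_simps power2_eq_square)
    also have "\<dots> = X + Z - 2 * Y"
      using assms by (simp add: defs divide_simps) (simp add: algebra_simps)
    finally show "(2 * x + 2) / (x * (x + 2))\<^sup>2 / ((x + 1)\<^sup>2 / (x * (x + 2))) = X + Z - 2 * Y" .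
  qed
  note D = p q r L0 L1 M1 M2 M3 M4 M5 M6 M7
  have "(trilog_part has_real_derivative
      - (1 / 6) * ((- p)\<^sup>2 / 2 * (X - Y))
      + 1 / 2 * ((p - q)\<^sup>2 / 2 * Y - (- q)\<^sup>2 / 2 * (Y - X))
      + 1 / 3 * ((- r)\<^sup>2 / 2 * (Z - Y) - (p - r)\<^sup>2 / 2 * Z + (p - r)\<^sup>2 / 2 * (Z - Y)
          - (- p - r)\<^sup>2 / 2 * (X + Z - 2 * Y))) (at x)"
    unfolding trilog_part_def[abs_def] by (intro DERIV_add DERIV_diff DERIV_cmult D)
  moreover have "(log_part has_real_derivative
      (2 * p * X * (r - p) + (Z - X) * p\<^sup>2) / 2 + (X * (r - p)\<^sup>2 + 2 * (r - p) * (Z - X) * p) / 6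
      - (2 * p * X * (q - p) + (Y - X) * p\<^sup>2)
      - (X * (q - p)\<^sup>2 + 2 * (q - p) * (Y - X) * p) / 4) (at x)"
    unfolding log_part_def[abs_def]
    unfolding p_def q_def r_def
    by (intro DERIV_add DERIV_diff DERIV_mult DERIV_cdivide DERIV_square p q r)
  moreover have "((\<lambda>x. ln x * (polylog 2 (- 1 / (x + 1)) - polylog 2 (- 1 / x))) has_real_derivative
      X * (polylog 2 (- 1 / (x + 1)) - polylog 2 (- 1 / x)) + ((r - q) * Y - (q - p) * X) * p) (at x)"
    unfolding p_def by (intro DERIV_mult DERIV_diff D[unfolded p_def])
  ultimately have "(antideriv has_real_derivative
      X * (polylog 2 (- 1 / (x + 1)) - polylog 2 (- 1 / x)) + ((r - q) * Y - (q - p) * X) * p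
      - (- (1 / 6) * ((- p)\<^sup>2 / 2 * (X - Y))
      + 1 / 2 * ((p - q)\<^sup>2 / 2 * Y - (- q)\<^sup>2 / 2 * (Y - X))
      + 1 / 3 * ((- r)\<^sup>2 / 2 * (Z - Y) - (p - r)\<^sup>2 / 2 * Z + (p - r)\<^sup>2 / 2 * (Z - Y)
          - (- p - r)\<^sup>2 / 2 * (X + Z - 2 * Y)))
      - ((2 * p * X * (r - p) + (Z - X) * p\<^sup>2) / 2 + (X * (r - p)\<^sup>2 + 2 * (r - p) * (Z - X) * p) / 6
      - (2 * p * X * (q - p) + (Y - X) * p\<^sup>2)
      - (X * (q - p)\<^sup>2 + 2 * (q - p) * (Y - X) * p) / 4)) (at x)"
    unfolding antideriv_def[abs_def] by (intro DERIV_diff)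
  \<comment> \<open>A polynomial identity in which \<open>p\<close>, \<open>q\<close>,
    \<open>r\<close>, \<open>X\<close>, \<open>Y\<close>, \<open>Z\<close> act as independent
    variables: partial fractions were already taken in the single derivatives.\<close>
  also have "X * (polylog 2 (- 1 / (x + 1)) - polylog 2 (- 1 / x)) + ((r - q) * Y - (q - p) * X) * p
      - (- (1 / 6) * ((- p)\<^sup>2 / 2 * (X - Y))
      + 1 / 2 * ((p - q)\<^sup>2 / 2 * Y - (- q)\<^sup>2 / 2 * (Y - X))
      + 1 / 3 * ((- r)\<^sup>2 / 2 * (Z - Y) - (p - r)\<^sup>2 / 2 * Z + (p - r)\<^sup>2 / 2 * (Z - Y)
          - (- p - r)\<^sup>2 / 2 * (X + Z - 2 * Y)))
      - ((2 * p * X * (r - p) + (Z - X) * p\<^sup>2) / 2 + (X * (r - p)\<^sup>2 + 2 * (r - p) * (Z - X) * p) / 6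
      - (2 * p * X * (q - p) + (Y - X) * p\<^sup>2)
      - (X * (q - p)\<^sup>2 + 2 * (q - p) * (Y - X) * p) / 4)
      = X * (polylog 2 (- 1 / (x + 1)) - polylog 2 (- 1 / x))"
    by (simp add: field_simps power2_eq_square)
  also have "\<dots> = (polylog 2 (- 1 / (x + 1)) - polylog 2 (- 1 / x)) / x"
    by (simp add: X_def)
  finally show ?thesis .
qed

section \<open>Limits of the antiderivative at 1 and at infinity\<close>

text \<open>The factor \<open>ln x\<close> kills the dilogarithms and all of
  \<open>log_part\<close>; after the pairwise cancellation \<open>trilog (- 1) / 6\<close> is
  left.\<close>

lemma tendsto_antideriv_at_right_1: "(antideriv \<longlongrightarrow> - zeta 3 / 8) (at_right 1)"
proof -
  have ev: "eventually (\<lambda>x::real. x > 1) (at_right 1)"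
    by (simp add: eventually_at_right_less)
  have L: "((\<lambda>x. polylog 2 (- 1 / x)) \<longlongrightarrow> polylog 2 (-1)) (at_right 1)"
      "((\<lambda>x. polylog 2 (- 1 / (x + 1))) \<longlongrightarrow> polylog 2 (- 1 / 2)) (at_right 1)"
    by (rule tendsto_polylog_2, real_asymp, simp, rule eventually_mono[OF ev], simp add: field_simps)+
  have ln: "(ln \<longlongrightarrow> (0::real)) (at_right 1)" by real_asymp
  have "((\<lambda>x. trilog (- 1 / x)) \<longlongrightarrow> trilog (-1)) (at_right 1)"
    "((\<lambda>x. trilog (x / (x + 1))) \<longlongrightarrow> trilog (1 / 2)) (at_right 1)"
    "((\<lambda>x. trilog (1 / (x + 1))) \<longlongrightarrow> trilog (1 / 2)) (at_right 1)"
    "((\<lambda>x. trilog (1 / (x + 2))) \<longlongrightarrow> trilog (1 / 3)) (at_right 1)"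
    "((\<lambda>x. trilog (x / (x + 2))) \<longlongrightarrow> trilog (1 / 3)) (at_right 1)"
    "((\<lambda>x. trilog (- x / (x + 2))) \<longlongrightarrow> trilog (- 1 / 3)) (at_right 1)"
    by (rule tendsto_trilog, real_asymp, simp, rule eventually_mono[OF ev], simp add: field_simps)+
  moreover have "((\<lambda>x. trilog (- 1 / (x * (x + 2)))) \<longlongrightarrow> trilog (- 1 / 3)) (at_right 1)"
    by (rule tendsto_trilog, real_asymp, simp) (rule eventually_mono[OF ev], rule neg_inverse_mult_bounds)
  ultimately have "(trilog_part \<longlongrightarrow> - (1 / 6) * trilog (- 1)
      + 1 / 2 * (trilog (1 / 2) - trilog (1 / 2))
      + 1 / 3 * (trilog (1 / 3) - trilog (1 / 3) + trilog (- 1 / 3) - trilog (- 1 / 3))) (at_right 1)"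
    unfolding trilog_part_def[abs_def] by (intro tendsto_intros)
  moreover have "(log_part \<longlongrightarrow> 0) (at_right 1)"
    unfolding log_part_def[abs_def] by real_asymp
  ultimately have "(antideriv \<longlongrightarrow> 0 * (polylog 2 (- 1 / 2) - polylog 2 (-1))
      - (- (1 / 6) * trilog (- 1)
      + 1 / 2 * (trilog (1 / 2) - trilog (1 / 2))
      + 1 / 3 * (trilog (1 / 3) - trilog (1 / 3) + trilog (- 1 / 3) - trilog (- 1 / 3))) - 0) (at_right 1)"
    unfolding antideriv_def[abs_def] by (intro tendsto_diff tendsto_mult L ln)
  then show ?thesis
    by (simp add: trilog_at_minus_1)
qed

lemma tendsto_antideriv_at_top: "(antideriv \<longlongrightarrow> zeta 3 / 12) at_top"
proof -
  have ev: "eventually (\<lambda>x::real. x > 1) at_top"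
    by (rule eventually_gt_at_top)
  \<comment> \<open>Since \<open>polylog 2 v\<close> behaves like \<open>v\<close> near 0, the
    product decays like \<open>ln x / x\<close>. The shifts \<open>c = 0\<close> and
    \<open>c = 1\<close> are needed.\<close>
  have L: "((\<lambda>x. ln x * polylog 2 (- 1 / (x + c))) \<longlongrightarrow> 0) at_top" for c
  proof -
    have "filterlim (\<lambda>x. - 1 / (x + c)) (at 0) at_top"
      by real_asymp
    from filterlim_compose[OF polylog_over_id_tendsto[of 1] this]
    have "((\<lambda>x. polylog 2 (- 1 / (x + c)) / (- 1 / (x + c))) \<longlongrightarrow> 1) at_top"
      by (simp add: numeral_2_eq_2)
    moreover have "((\<lambda>x. ln x * (- 1 / (x + c))) \<longlongrightarrow> 0) at_top"
      by real_asymp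
    ultimately have "((\<lambda>x. ln x * (- 1 / (x + c)) * (polylog 2 (- 1 / (x + c)) / (- 1 / (x + c))))
        \<longlongrightarrow> 0 * 1) at_top"
      by (intro tendsto_mult)
    moreover have "eventually (\<lambda>x. ln x * (- 1 / (x + c)) * (polylog 2 (- 1 / (x + c)) / (- 1 / (x + c)))
        = ln x * polylog 2 (- 1 / (x + c))) at_top"
      using eventually_gt_at_top[of "- c"] by eventually_elim auto
    ultimately show ?thesis
      by (auto intro: Lim_transform_eventually)
  qed
  have "((\<lambda>x. trilog (- 1 / x)) \<longlongrightarrow> trilog 0) at_top"
    "((\<lambda>x. trilog (x / (x + 1))) \<longlongrightarrow> trilog 1) at_top"
    "((\<lambda>x. trilog (1 / (x + 1))) \<longlongrightarrow> trilog 0) at_top"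
    "((\<lambda>x. trilog (1 / (x + 2))) \<longlongrightarrow> trilog 0) at_top"
    "((\<lambda>x. trilog (x / (x + 2))) \<longlongrightarrow> trilog 1) at_top"
    "((\<lambda>x. trilog (- x / (x + 2))) \<longlongrightarrow> trilog (- 1)) at_top"
    by (rule tendsto_trilog, real_asymp, simp, rule eventually_mono[OF ev], simp add: field_simps)+
  moreover have "((\<lambda>x. trilog (- 1 / (x * (x + 2)))) \<longlongrightarrow> trilog 0) at_top"
    by (rule tendsto_trilog, real_asymp, simp) (rule eventually_mono[OF ev], rule neg_inverse_mult_bounds)
  \<comment> \<open>In units of \<open>zeta 3\<close> this limit is
    \<open>1 / 2 + 1 / 3 * (- 1 - 3 / 4) = - 1 / 12\<close>.\<close>
  ultimately have "(trilog_part \<longlongrightarrow> - (1 / 6) * trilog 0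
      + 1 / 2 * (trilog 1 - trilog 0)
      + 1 / 3 * (trilog 0 - trilog 1 + trilog (- 1) - trilog 0)) at_top"
    unfolding trilog_part_def[abs_def] by (intro tendsto_intros)
  \<comment> \<open>Every term contains a difference \<open>ln (x + c) - ln x\<close> of order
    \<open>1 / x\<close>, which beats the powers of \<open>ln x\<close>.\<close>
  moreover have "(log_part \<longlongrightarrow> 0) at_top"
    unfolding log_part_def[abs_def] by real_asymp
  moreover have "((\<lambda>x. ln x * (polylog 2 (- 1 / (x + 1)) - polylog 2 (- 1 / x))) \<longlongrightarrow> 0) at_top"
    using tendsto_diff[OF L[of 1] L[of 0]] by (simp add: right_diff_distrib)
  ultimately have "(antideriv \<longlongrightarrow> 0 - (- (1 / 6) * trilog 0
      + 1 / 2 * (trilog 1 - trilog 0)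
      + 1 / 3 * (trilog 0 - trilog 1 + trilog (- 1) - trilog 0)) - 0) at_top"
    unfolding antideriv_def[abs_def] by (intro tendsto_diff)
  then show ?thesis
    by (simp add: trilog_at_0 trilog_at_1 trilog_at_minus_1)
qed

section \<open>Integration over x\<close>

theorem theorem1p1:
  "(LBINT x=1..\<infinity>. (LBINT y=0..1. (LBINT z=0..1. 1 / (x * (x + y) * (x + y + z)))))
    = 5 / 24 * zeta 3"
proof -
  let ?f = "\<lambda>x. (polylog 2 (- 1 / (x + 1)) - polylog 2 (- 1 / x)) / x"
  have "(LBINT x=1..\<infinity>. (LBINT y=0..1. (LBINT z=0..1. 1 / (x * (x + y) * (x + y + z)))))
      = (LBINT x=ereal 1..\<infinity>. ?f x)"
    unfolding one_ereal_def[symmetric]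
    by (intro interval_integral_cong integral_y_z) (auto simp: einterval_def min_def)
  also have "\<dots> = zeta 3 / 12 - (- zeta 3 / 8)"
  \<comment> \<open>For a nonnegative integrand, finite limits of the antiderivative at both ends
    suffice on the unbounded interval; integrability need not be shown separately.\<close>
  proof (rule interval_integral_FTC_nonneg(2)[where F = antideriv])
    show "((antideriv \<circ> real_of_ereal) \<longlongrightarrow> - zeta 3 / 8) (at_right (ereal 1))"
      "((antideriv \<circ> real_of_ereal) \<longlongrightarrow> zeta 3 / 12) (at_left \<infinity>)"
      using tendsto_antideriv_at_right_1 tendsto_antideriv_at_top by (simp_all add: ereal_tendsto_simps)
    fix x assume "ereal 1 < ereal x"
    then have "x > 1" by simp
    then show "(antideriv has_real_derivative ?f x) (at x)"
      by (rule DERIV_antideriv)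
    have "isCont (\<lambda>s. polylog 2 (- 1 / s)) s" if "s > 1" for s
      using DERIV_polylog_2_neg_inverse[OF that] by (rule DERIV_isCont)
    then have "isCont (\<lambda>s. polylog 2 (- 1 / s)) x" "isCont (\<lambda>x. polylog 2 (- 1 / (x + 1))) x"
      using \<open>x > 1\<close> isCont_o2[of x "\<lambda>x. x + 1" "\<lambda>s. polylog 2 (- 1 / s)"] by auto
    then show "isCont ?f x"
      using \<open>x > 1\<close> by (intro continuous_intros) auto
  next
    have "0 \<le> ?f x" if "x > 1" for x
    proof -
      \<comment> \<open>Nonnegativity amounts to monotonicity of \<open>polylog 2 (- 1 / s)\<close>
        in \<open>s\<close>, whose derivative is \<open>ln (1 + 1 / s) / s\<close>.\<close>
      have "polylog 2 (- 1 / x) \<le> polylog 2 (- 1 / (x + 1))"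
      proof (rule DERIV_nonneg_imp_nondecreasing[where f = "\<lambda>s. polylog 2 (- 1 / s)"])
        fix s assume "x \<le> s"
        with that have "s > 1" by simp
        then show "\<exists>d. ((\<lambda>s. polylog 2 (- 1 / s)) has_real_derivative d) (at s) \<and> 0 \<le> d"
          by (intro exI[of _ "(ln (s + 1) - ln s) / s"] conjI DERIV_polylog_2_neg_inverse) auto
      qed simp
      then show ?thesis using that by simp
    qed
    then show "AE x in lborel. ereal 1 < ereal x \<longrightarrow> ereal x < \<infinity> \<longrightarrow> 0 \<le> ?f x"
      by simp
  qed simp
  finally show ?thesis by simp
qed

end
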